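(* Let $\mathcal{V}$ be a nondistributive variety of lattices. Then the free lattice (resp., the free bounded lattice) on $\aleph_1$ generators within $\mathcal{V}$ has no congruence-permutable, congruence-preserving extension.
   Context: A variety of lattices is nondistributive if it contains a nondistributive lattice. The free bounded lattice within $\mathcal{V}$ is the free object in the class of bounded lattices whose lattice reduct belongs to $\mathcal{V}$, with respect to $0,1$-preserving lattice homomorphisms. An *algebra* is a structure with a nonempty universe, on an arbitrary language without relation symbols. An algebra $\mathbf{B}$ is a *congruence-preserving extension* of an algebra $\mathbf{A}$ if $A\subseteq B$, the language of $\mathbf{A}$ is contained in the language of $\mathbf{B}$, the inclusion map is a homomorphism from $\mathbf{A}$ to the reduct of $\mathbf{B}$ to the language of $\mathbf{A}$, and every congruence of $\mathbf{A}$ extends to a unique congruence of $\mathbf{B}$ (i.e., the map sending a congruence of $\mathbf{A}$ to the congruence of $\mathbf{B}$ it generates is an isomorphism $\mathrm{Con}\,\mathbf{A}\to\mathrm{Con}\,\mathbf{B}$). The language of $\mathbf{B}$ may be strictly larger than that of $\mathbf{A}$. An algebra is *congruence-permutable* if $\alpha\beta=\beta\alpha$ (composition of binary relations) for any two congruences $\alpha,\beta$ of it. *)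

theory Defs
  imports "HOL-Algebra.Lattice" "HOL-Library.FuncSet"
begin

unbundle cardinal_syntax

section \<open>Algebras over a language of finitary operation symbols\<close>

record ('f, 'a) algebra =
  universe :: "'a set"
  symbols :: "'f set"
  arity :: "'f \<Rightarrow> nat"
  operation :: "'f \<Rightarrow> 'a list \<Rightarrow> 'a"

definition arguments :: "('f, 'a) algebra \<Rightarrow> 'f \<Rightarrow> 'a list set"
  where "arguments A f = {xs. length xs = arity A f \<and> set xs \<subseteq> universe A}"

definition is_algebra :: "('f, 'a) algebra \<Rightarrow> bool"
  where "is_algebra A \<longleftrightarrow>
    universe A \<noteq> {} \<and>
    (\<forall>f\<in>symbols A. \<forall>xs\<in>arguments A f. operation A f xs \<in> universe A)"

definition congruences :: "('f, 'a) algebra \<Rightarrow> 'a rel set"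
  where "congruences A =
    {\<theta>. equiv (universe A) \<theta> \<and>
      (\<forall>f\<in>symbols A. \<forall>xs\<in>arguments A f. \<forall>ys\<in>arguments A f.
        list_all2 (\<lambda>x y. (x, y) \<in> \<theta>) xs ys \<longrightarrow>
        (operation A f xs, operation A f ys) \<in> \<theta>)}"

definition congruence_permutable :: "('f, 'a) algebra \<Rightarrow> bool"
  where "congruence_permutable A \<longleftrightarrow>
    (\<forall>\<alpha>\<in>congruences A. \<forall>\<beta>\<in>congruences A. \<alpha> O \<beta> = \<beta> O \<alpha>)"

text \<open>
  A congruence \<open>\<beta>\<close> of \<open>B\<close> extends the congruence \<open>\<alpha>\<close> of \<open>A\<close> if its restriction to
  the universe of \<open>A\<close> is \<open>\<alpha>\<close>.
\<close>
definition congruence_preserving_extension ::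
    "('f, 'a) algebra \<Rightarrow> ('f, 'a) algebra \<Rightarrow> bool"
  where "congruence_preserving_extension A B \<longleftrightarrow>
    is_algebra A \<and> is_algebra B \<and>
    universe A \<subseteq> universe B \<and>
    symbols A \<subseteq> symbols B \<and>
    (\<forall>f\<in>symbols A. arity B f = arity A f \<and>
      (\<forall>xs\<in>arguments A f. operation B f xs = operation A f xs)) \<and>
    (\<forall>\<alpha>\<in>congruences A. \<exists>!\<beta>. \<beta> \<in> congruences B \<and>
      \<beta> \<inter> (universe A \<times> universe A) = \<alpha>)"


section \<open>Lattices as algebras\<close>

text \<open>
  The constructor \<open>Extra\<close> leaves room for an arbitrary language extending that of
  (bounded) lattices.
\<close>
datatype 'g lattice_symbol = Join | Meet | Bot | Top | Extra 'g

fun lattice_arity :: "'g lattice_symbol \<Rightarrow> nat"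
  where
    "lattice_arity Join = 2"
  | "lattice_arity Meet = 2"
  | "lattice_arity _ = 0"

fun lattice_operation :: "'a gorder \<Rightarrow> 'g lattice_symbol \<Rightarrow> 'a list \<Rightarrow> 'a"
  where
    "lattice_operation L Join [x, y] = x \<squnion>\<^bsub>L\<^esub> y"
  | "lattice_operation L Meet [x, y] = x \<sqinter>\<^bsub>L\<^esub> y"
  | "lattice_operation L Bot [] = \<bottom>\<^bsub>L\<^esub>"
  | "lattice_operation L Top [] = \<top>\<^bsub>L\<^esub>"
  | "lattice_operation L _ _ = undefined"

definition lattice_algebra :: "'a gorder \<Rightarrow> ('g lattice_symbol, 'a) algebra"
  where "lattice_algebra L =
    \<lparr>universe = carrier L, symbols = {Join, Meet},
     arity = lattice_arity, operation = lattice_operation L\<rparr>"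

definition bounded_lattice_algebra :: "'a gorder \<Rightarrow> ('g lattice_symbol, 'a) algebra"
  where "bounded_lattice_algebra L =
    \<lparr>universe = carrier L, symbols = {Join, Meet, Bot, Top},
     arity = lattice_arity, operation = lattice_operation L\<rparr>"


section \<open>Varieties of lattices\<close>

datatype 'v lattice_term =
    Var 'v
  | JoinT "'v lattice_term" "'v lattice_term"
  | MeetT "'v lattice_term" "'v lattice_term"

primrec eval_term :: "'a gorder \<Rightarrow> ('v \<Rightarrow> 'a) \<Rightarrow> 'v lattice_term \<Rightarrow> 'a"
  where
    "eval_term L v (Var i) = v i"
  | "eval_term L v (JoinT s t) = eval_term L v s \<squnion>\<^bsub>L\<^esub> eval_term L v t"
  | "eval_term L v (MeetT s t) = eval_term L v s \<sqinter>\<^bsub>L\<^esub> eval_term L v t"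

text \<open>
  A variety is the class of all models of a set \<open>E\<close> of identities. As the constant is
  polymorphic in the type of elements, a variety is represented by \<open>E\<close>, and
  \<open>variety E :: 'a gorder set\<close> is the part of the variety living on the type \<open>'a\<close>.
\<close>
definition variety :: "(nat lattice_term \<times> nat lattice_term) set \<Rightarrow> 'a gorder set"
  where "variety E =
    {L. lattice L \<and> carrier L \<noteq> {} \<and>
      (\<forall>(s, t)\<in>E. \<forall>v. range v \<subseteq> carrier L \<longrightarrow> eval_term L v s = eval_term L v t)}"

definition bounded_variety :: "(nat lattice_term \<times> nat lattice_term) set \<Rightarrow> 'a gorder set"
  where "bounded_variety E = {L. bounded_lattice L \<and> L \<in> variety E}"

definition distributive :: "'a gorder \<Rightarrow> bool"
  where "distributive L \<longleftrightarrow>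
    (\<forall>x\<in>carrier L. \<forall>y\<in>carrier L. \<forall>z\<in>carrier L.
      x \<sqinter>\<^bsub>L\<^esub> (y \<squnion>\<^bsub>L\<^esub> z) = (x \<sqinter>\<^bsub>L\<^esub> y) \<squnion>\<^bsub>L\<^esub> (x \<sqinter>\<^bsub>L\<^esub> z))"


section \<open>Free objects\<close>

definition lattice_hom :: "'a gorder \<Rightarrow> 'b gorder \<Rightarrow> ('a \<Rightarrow> 'b) set"
  where "lattice_hom L K =
    {h \<in> carrier L \<rightarrow>\<^sub>E carrier K. \<forall>x\<in>carrier L. \<forall>y\<in>carrier L.
      h (x \<squnion>\<^bsub>L\<^esub> y) = h x \<squnion>\<^bsub>K\<^esub> h y \<and> h (x \<sqinter>\<^bsub>L\<^esub> y) = h x \<sqinter>\<^bsub>K\<^esub> h y}"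

definition bounded_lattice_hom :: "'a gorder \<Rightarrow> 'b gorder \<Rightarrow> ('a \<Rightarrow> 'b) set"
  where "bounded_lattice_hom L K =
    {h \<in> lattice_hom L K. h \<bottom>\<^bsub>L\<^esub> = \<bottom>\<^bsub>K\<^esub> \<and> h \<top>\<^bsub>L\<^esub> = \<top>\<^bsub>K\<^esub>}"

text \<open>
  HOL cannot quantify over the types of the test objects \<open>L\<close> below, so these live on the
  type \<open>'a\<close> of the elements of \<open>F\<close>. For infinite \<open>X\<close>, and for (bounded) lattices in a
  variety, this does not enlarge the class of free objects: the free object on \<open>X\<close> has the
  cardinality of \<open>X\<close>, hence has a copy on \<open>'a\<close>, and the universal property tested on
  that copy makes \<open>F\<close> isomorphic to it over \<open>X\<close>.
\<close>
definition free_object ::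
    "'a gorder set \<Rightarrow> ('a gorder \<Rightarrow> 'a gorder \<Rightarrow> ('a \<Rightarrow> 'a) set) \<Rightarrow> 'a set \<Rightarrow> 'a gorder \<Rightarrow> bool"
  where "free_object C Hom X F \<longleftrightarrow>
    F \<in> C \<and> X \<subseteq> carrier F \<and>
    (\<forall>L\<in>C. \<forall>f\<in>X \<rightarrow> carrier L. \<exists>!h. h \<in> Hom F L \<and> (\<forall>x\<in>X. h x = f x))"

end

theory Submission
  imports Defs "HOL-Library.Countable_Set_Type"
begin

text \<open>
  A nondistributive lattice contains \<open>p \<noteq> q\<close> and \<open>r\<close> with \<open>r \<sqinter> p = r \<sqinter> q = u\<close> and
  \<open>r \<squnion> p = r \<squnion> q = v\<close>; let \<open>K\<close> be the countable sublattice they generate. Fix free generators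
  \<open>a\<^sub>0, a\<^sub>1, a\<^sub>2\<close>. For another generator \<open>x\<close> and \<open>c \<in> {p, q}\<close>, send
  \<open>a\<^sub>0, a\<^sub>1, a\<^sub>2, x\<close> to \<open>u, r, v, c\<close> and the remaining generators to \<open>u\<close>. The image lies in the
  square \<open>{u, r, c, v}\<close>, whose two projections give congruences \<open>\<kappa>\<^sub>1 x\<close>, containing
  \<open>(a\<^sub>0, x)\<close> and \<open>(a\<^sub>1, a\<^sub>2)\<close>, and \<open>\<kappa>\<^sub>2 x\<close>, containing \<open>(a\<^sub>0, a\<^sub>1)\<close> and
  \<open>(x, a\<^sub>2)\<close>. In a congruence-permutable, congruence-preserving extension, permuting the
  extensions of \<open>\<Inter>x. \<kappa>\<^sub>1 x\<close> and \<open>\<Inter>x. \<kappa>\<^sub>2 x\<close> yields one \<open>t\<close> such that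
  \<open>(t, x)\<close> belongs to the extension of \<open>\<kappa>\<^sub>1 x \<inter> \<kappa>\<^sub>2 x\<close> for all \<open>x\<close> at once. This congruence lies
  in a directed union of congruences \<open>\<Lambda> x S\<close> that only constrain a finite set \<open>S\<close> of generators,
  so \<open>(t, x)\<close> belongs to the extension of \<open>\<Lambda> x (S x)\<close> for some finite \<open>S x\<close>. Uncountability
  provides \<open>x \<noteq> y\<close> with \<open>x \<notin> S y\<close> and \<open>y \<notin> S x\<close>, and a homomorphism sending \<open>x\<close> to \<open>p\<close> and
  \<open>y\<close> to \<open>q\<close> then identifies \<open>x\<close> with \<open>y\<close> through \<open>t\<close>, a contradiction.
\<close>

section \<open>Cancellation implies distributivity\<close>

context lattice
begin

text \<open>If the two sides \<open>u\<close> and \<open>v\<close> differed, they would form a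
  pentagon with \<open>b\<close>: \<open>u \<sqsubseteq> v\<close>, and both have the same meet and
  the same join with \<open>b\<close>. Cancellation rules this out.\<close>

lemma modular_law:
  assumes cancel: "\<And>p q r. \<lbrakk>p \<in> carrier L; q \<in> carrier L; r \<in> carrier L;
      r \<sqinter> p = r \<sqinter> q; r \<squnion> p = r \<squnion> q\<rbrakk> \<Longrightarrow> p = q"
    and [simp]: "a \<in> carrier L" "b \<in> carrier L" "c \<in> carrier L"
    and "a \<sqsubseteq> c"
  shows "a \<squnion> (b \<sqinter> c) = (a \<squnion> b) \<sqinter> c"
proof -
  define u v where uv: "u = a \<squnion> (b \<sqinter> c)" "v = (a \<squnion> b) \<sqinter> c"
  have [simp]: "u \<in> carrier L" "v \<in> carrier L"
    by (simp_all add: uv)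
  have bc: "b \<sqinter> c \<sqsubseteq> u" and au: "a \<sqsubseteq> u" and vc: "v \<sqsubseteq> c" and vab: "v \<sqsubseteq> a \<squnion> b"
    unfolding uv by (simp_all add: join_left join_right meet_left meet_right)
  have "a \<sqsubseteq> v" "b \<sqinter> c \<sqsubseteq> v"
    unfolding uv using \<open>a \<sqsubseteq> c\<close>
    by (auto intro!: meet_le simp: join_left meet_right
        intro: le_trans[OF meet_left join_right])
  then have uv_le: "u \<sqsubseteq> v"
    unfolding uv(1) by (intro join_le) auto
  have bv: "b \<sqinter> v \<sqsubseteq> u"
    by (rule le_trans[OF _ bc]) (auto intro!: meet_le intro: meet_left le_trans[OF meet_right vc])
  have "b \<sqinter> u = b \<sqinter> v"
    by (rule le_antisym) (auto intro!: meet_le intro: meet_left bv le_trans[OF meet_right uv_le])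
  moreover have vbu: "v \<sqsubseteq> b \<squnion> u"
    by (rule le_trans[OF vab]) (auto intro!: join_le intro: join_left le_trans[OF au join_right])
  have "b \<squnion> u = b \<squnion> v"
    by (rule le_antisym) (auto intro!: join_le intro: join_left vbu le_trans[OF uv_le join_right])
  ultimately show ?thesis
    using cancel[of u v b] by (simp add: uv)
qed

text \<open>This supplies the pairwise meets of the diamond built below. Modularity reduces the meet
  to \<open>d \<squnion> ((x \<sqinter> e) \<sqinter> q)\<close>, and a second use bounds
  \<open>(x \<sqinter> e) \<sqinter> q\<close> by
  \<open>(x \<sqinter> z) \<squnion> (y \<sqinter> x) \<sqsubseteq> d\<close>. Keeping
  \<open>d\<close> and \<open>e\<close> abstract lets the dual lattice yield the pairwise
  joins.\<close>

lemma modular_median_meet: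
  assumes modular: "\<And>a b c. \<lbrakk>a \<in> carrier L; b \<in> carrier L; c \<in> carrier L; a \<sqsubseteq> c\<rbrakk> \<Longrightarrow>
      a \<squnion> (b \<sqinter> c) = (a \<squnion> b) \<sqinter> c"
    and [simp]: "x \<in> carrier L" "y \<in> carrier L" "z \<in> carrier L" "d \<in> carrier L" "e \<in> carrier L"
    and d: "x \<sqinter> y \<sqsubseteq> d" "x \<sqinter> z \<sqsubseteq> d" "d \<sqsubseteq> y \<squnion> (x \<sqinter> z)"
  shows "(d \<squnion> (x \<sqinter> e)) \<sqinter> (d \<squnion> (y \<sqinter> e)) = d"
proof -
  define q where "q = d \<squnion> (y \<sqinter> e)"
  have [simp]: "q \<in> carrier L"
    by (simp add: q_def)
  have "d \<sqsubseteq> q"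
    by (simp add: q_def join_left)
  have q_le: "q \<sqsubseteq> y \<squnion> (x \<sqinter> z)"
    unfolding q_def using d by (auto intro!: join_le intro: le_trans[OF meet_left join_left])
  have eq: "(x \<sqinter> z) \<squnion> (y \<sqinter> x) = ((x \<sqinter> z) \<squnion> y) \<sqinter> x"
    by (rule modular) (simp_all add: meet_left)
  have "(x \<sqinter> e) \<sqinter> q \<sqsubseteq> ((x \<sqinter> z) \<squnion> y) \<sqinter> x"
    using q_le join_comm[of L y "x \<sqinter> z"]
    by (auto intro!: meet_le intro: le_trans[OF meet_right] le_trans[OF meet_left meet_left])
  moreover have "(x \<sqinter> z) \<squnion> (y \<sqinter> x) \<sqsubseteq> d"
    using d meet_comm[of L x y] by (auto intro!: join_le)
  ultimately have "(x \<sqinter> e) \<sqinter> q \<sqsubseteq> d"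
    unfolding eq by (rule le_trans) simp_all
  then have "d \<squnion> ((x \<sqinter> e) \<sqinter> q) = d"
    by (intro le_antisym join_le) (simp_all add: join_left)
  then show ?thesis
    using modular[of d "x \<sqinter> e" q] \<open>d \<sqsubseteq> q\<close> by (simp add: q_def)
qed

end

text \<open>
  In a modular lattice the three elements \<open>d \<squnion> (x \<sqinter> e)\<close>, \<open>d \<squnion> (y \<sqinter> e)\<close>, \<open>d \<squnion> (z \<sqinter> e)\<close>,
  where \<open>d\<close> and \<open>e\<close> are the two medians of \<open>x\<close>, \<open>y\<close>, \<open>z\<close>, have pairwise meet \<open>d\<close> and
  pairwise join \<open>e\<close>. Cancellation thus forces \<open>d = e\<close>.
\<close>

lemma distributive_if_cancellative:
  fixes L :: "'a gorder" (structure)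
  assumes "lattice L"
    and cancel: "\<And>p q r. \<lbrakk>p \<in> carrier L; q \<in> carrier L; r \<in> carrier L;
      r \<sqinter> p = r \<sqinter> q; r \<squnion> p = r \<squnion> q\<rbrakk> \<Longrightarrow> p = q"
  shows "distributive L"
  unfolding distributive_def
proof (intro ballI)
  interpret lattice L by fact
  fix x y z
  assume [simp]: "x \<in> carrier L" "y \<in> carrier L" "z \<in> carrier L"
  have modular: "a \<squnion> (b \<sqinter> c) = (a \<squnion> b) \<sqinter> c"
    if "a \<in> carrier L" "b \<in> carrier L" "c \<in> carrier L" "a \<sqsubseteq> c" for a b c
    using modular_law cancel that by blast
  interpret dual: lattice "inv_gorder L"
    by (rule dual_lattice)
  have dual_modular: "a \<sqinter> (b \<squnion> c) = (a \<sqinter> b) \<squnion> c"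
    if [simp]: "a \<in> carrier L" "b \<in> carrier L" "c \<in> carrier L" and "c \<sqsubseteq> a" for a b c
    using modular[of c b a] that by (simp add: meet_comm[of L a] join_comm[of L c])
  define d e where de: "d = (x \<sqinter> y) \<squnion> ((y \<sqinter> z) \<squnion> (z \<sqinter> x))" "e = (x \<squnion> y) \<sqinter> ((y \<squnion> z) \<sqinter> (z \<squnion> x))"
  have [simp]: "d \<in> carrier L" "e \<in> carrier L"
    by (simp_all add: de)
  have d_ge: "x \<sqinter> y \<sqsubseteq> d" "y \<sqinter> z \<sqsubseteq> d" "z \<sqinter> x \<sqsubseteq> d"
    unfolding de by (auto intro: join_left le_trans[OF join_left join_right] le_trans[OF join_right join_right])
  have d_le: "d \<sqsubseteq> u" if "u \<in> carrier L" "x \<sqinter> y \<sqsubseteq> u" "y \<sqinter> z \<sqsubseteq> u" "z \<sqinter> x \<sqsubseteq> u" for u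
    unfolding de using that by (auto intro!: join_le)
  have e_le: "e \<sqsubseteq> x \<squnion> y" "e \<sqsubseteq> y \<squnion> z" "e \<sqsubseteq> z \<squnion> x"
    unfolding de by (auto intro: meet_left le_trans[OF meet_right meet_left] le_trans[OF meet_right meet_right])
  have e_ge: "u \<sqsubseteq> e" if "u \<in> carrier L" "u \<sqsubseteq> x \<squnion> y" "u \<sqsubseteq> y \<squnion> z" "u \<sqsubseteq> z \<squnion> x" for u
    unfolding de using that by (auto intro!: meet_le)
  have meet_le_join: "u \<sqinter> v \<sqsubseteq> u \<squnion> w" "u \<sqinter> v \<sqsubseteq> w \<squnion> u" "v \<sqinter> u \<sqsubseteq> u \<squnion> w" "v \<sqinter> u \<sqsubseteq> w \<squnion> u"
    if "u \<in> carrier L" "v \<in> carrier L" "w \<in> carrier L" for u v w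
    using that by (auto intro: le_trans[OF meet_left join_left] le_trans[OF meet_left join_right]
        le_trans[OF meet_right join_left] le_trans[OF meet_right join_right])
  have "d \<sqsubseteq> e"
    by (auto intro!: d_le e_ge meet_le_join)
  define P where "P u = d \<squnion> (u \<sqinter> e)" for u
  have [simp]: "P u \<in> carrier L" if "u \<in> carrier L" for u
    using that by (simp add: P_def)
  \<comment> \<open>The other bracketing, available by modularity since
    \<open>d \<sqsubseteq> e\<close>, is the form in which the dual of
    \<open>modular_median_meet\<close> computes joins.\<close>
  have P_dual: "P u = e \<sqinter> (u \<squnion> d)" if "u \<in> carrier L" for u
    using modular[of d u e] \<open>d \<sqsubseteq> e\<close> that
    by (simp add: P_def meet_comm[of L e] join_comm[of L u])
  have meets: "P u \<sqinter> P v = d" if "(u, v, w) \<in> {(x, y, z), (y, z, x), (z, x, y)}" for u v w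
    unfolding P_def using that d_ge
    by (intro modular_median_meet[where z = w] modular d_le)
      (auto simp: meet_comm[of L x z] meet_comm[of L y x] meet_comm[of L z y] join_right meet_le_join)
  have joins: "P u \<squnion> P v = e" if "(u, v, w) \<in> {(x, y, z), (y, z, x), (z, x, y)}" for u v w
  proof -
    have "(e \<sqinter> (u \<squnion> d)) \<squnion> (e \<sqinter> (v \<squnion> d)) = e"
      using that e_le
      by (intro dual.modular_median_meet[where z = w, simplified] dual_modular e_ge)
        (auto simp: join_comm[of L x z] join_comm[of L y x] join_comm[of L z y] meet_right meet_le_join)
    then show ?thesis
      using that by (auto simp: P_dual)
  qed
  have "P x = P y"
  proof (rule cancel[of _ _ "P z"])
    show "P z \<sqinter> P x = P z \<sqinter> P y"
      using meets[of z x y] meets[of y z x] by (simp add: meet_comm[of L "P z" "P y"])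
    show "P z \<squnion> P x = P z \<squnion> P y"
      using joins[of z x y] joins[of y z x] by (simp add: join_comm[of L "P z" "P y"])
  qed simp_all
  \<comment> \<open>Once two of the three elements coincide, idempotence makes both their meet
    \<open>d\<close> and their join \<open>e\<close> equal to that element.\<close>
  moreover have "P y \<squnion> P y = P y" "P y \<sqinter> P y = P y"
    by (auto intro!: le_antisym join_le meet_le join_left meet_left)
  ultimately have "d = e"
    using meets[of x y z] joins[of x y z] by simp
  \<comment> \<open>Distributivity comes from \<open>x \<sqinter> (y \<squnion> z) \<sqsubseteq> e =
    d \<sqsubseteq> a \<squnion> (y \<sqinter> z)\<close>: meeting with \<open>x\<close> and
    applying modularity leaves only \<open>a\<close>.\<close>
  define a where "a = (x \<sqinter> y) \<squnion> (x \<sqinter> z)"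
  have [simp]: "a \<in> carrier L"
    by (simp add: a_def)
  have "a \<sqsubseteq> x"
    by (auto simp: a_def intro!: join_le meet_left)
  have xy_a: "x \<sqinter> y \<sqsubseteq> a" and xz_a: "x \<sqinter> z \<sqsubseteq> a"
    by (simp_all add: a_def join_left join_right)
  have "x \<sqinter> (y \<squnion> z) \<sqsubseteq> e"
    by (auto intro!: e_ge meet_le_join meet_right)
  moreover have "d \<sqsubseteq> a \<squnion> (y \<sqinter> z)"
    using xy_a xz_a by (auto intro!: d_le intro: join_right le_trans[OF _ join_left]
        simp: meet_comm[of L z x])
  ultimately have "x \<sqinter> (y \<squnion> z) \<sqsubseteq> a \<squnion> (y \<sqinter> z)"
    using \<open>d = e\<close> by (auto intro: le_trans)
  then have "x \<sqinter> (y \<squnion> z) \<sqsubseteq> (a \<squnion> (y \<sqinter> z)) \<sqinter> x"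
    by (auto intro!: meet_le meet_left)
  also have "\<dots> = a \<squnion> ((y \<sqinter> z) \<sqinter> x)"
    using \<open>a \<sqsubseteq> x\<close> by (simp add: modular)
  also have "\<dots> = a"
  proof -
    have "(y \<sqinter> z) \<sqinter> x \<sqsubseteq> x \<sqinter> y"
      by (auto intro!: meet_le intro: meet_right le_trans[OF meet_left meet_left])
    then have "(y \<sqinter> z) \<sqinter> x \<sqsubseteq> a"
      using xy_a by (auto intro: le_trans)
    then show ?thesis
      by (intro le_antisym join_le) (auto intro: join_left)
  qed
  finally have "x \<sqinter> (y \<squnion> z) \<sqsubseteq> a" .
  moreover have "a \<sqsubseteq> x \<sqinter> (y \<squnion> z)"
    unfolding a_def
    by (auto intro!: join_le meet_le meet_left intro: le_trans[OF meet_right join_left]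
        le_trans[OF meet_right join_right])
  ultimately show "x \<sqinter> (y \<squnion> z) = (x \<sqinter> y) \<squnion> (x \<sqinter> z)"
    unfolding a_def[symmetric] by (intro le_antisym) auto
qed

section \<open>Extending congruences\<close>

lemma congruences_equiv: "\<theta> \<in> congruences A \<Longrightarrow> equiv (universe A) \<theta>"
  by (simp add: congruences_def)

lemma congruences_operation:
  "\<lbrakk>\<theta> \<in> congruences A; f \<in> symbols A; xs \<in> arguments A f; ys \<in> arguments A f;
    list_all2 (\<lambda>x y. (x, y) \<in> \<theta>) xs ys\<rbrakk> \<Longrightarrow> (operation A f xs, operation A f ys) \<in> \<theta>"
  by (simp add: congruences_def)

lemma congruencesI:
  assumes "equiv (universe A) \<theta>"
    and "\<And>f xs ys. \<lbrakk>f \<in> symbols A; xs \<in> arguments A f; ys \<in> arguments A f;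
      list_all2 (\<lambda>x y. (x, y) \<in> \<theta>) xs ys\<rbrakk> \<Longrightarrow> (operation A f xs, operation A f ys) \<in> \<theta>"
  shows "\<theta> \<in> congruences A"
  using assms by (simp add: congruences_def)

lemma congruences_Inter:
  assumes "C \<noteq> {}" "C \<subseteq> congruences A"
  shows "\<Inter>C \<in> congruences A"
proof (rule congruencesI)
  have eqv: "equiv (universe A) \<theta>" if "\<theta> \<in> C" for \<theta>
    using assms(2) congruences_equiv that by blast
  show "equiv (universe A) (\<Inter>C)"
  proof (rule equivI)
    show "\<Inter>C \<subseteq> universe A \<times> universe A"
      using assms(1) eqv by (auto dest!: equiv_type)
    show "refl_on (universe A) (\<Inter>C)"
      using assms(1) eqv by (auto simp: refl_on_def equiv_def)
    show "sym (\<Inter>C)"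
      using eqv by (auto simp: equiv_def intro!: symI dest: symD)
    show "trans (\<Inter>C)"
      using eqv unfolding equiv_def by (meson InterI InterD transI transD)
  qed
next
  fix f xs ys
  assume f: "f \<in> symbols A" "xs \<in> arguments A f" "ys \<in> arguments A f"
    and *: "list_all2 (\<lambda>x y. (x, y) \<in> \<Inter>C) xs ys"
  show "(operation A f xs, operation A f ys) \<in> \<Inter>C"
  proof
    fix \<theta>
    assume "\<theta> \<in> C"
    moreover from this have "list_all2 (\<lambda>x y. (x, y) \<in> \<theta>) xs ys"
      by (intro list_all2_mono[OF *]) auto
    ultimately show "(operation A f xs, operation A f ys) \<in> \<theta>"
      using f assms(2) by (intro congruences_operation) auto
  qed
qed

text \<open>Operations are finitary: an argument list involves finitely many pairs, so directedness
  gathers the members of \<open>C\<close> that witness them into one.\<close>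

lemma directed_list_all2:
  assumes "C \<noteq> {}" and directed: "\<And>\<alpha> \<beta>. \<lbrakk>\<alpha> \<in> C; \<beta> \<in> C\<rbrakk> \<Longrightarrow> \<exists>\<gamma>\<in>C. \<alpha> \<union> \<beta> \<subseteq> \<gamma>"
    and "list_all2 (\<lambda>x y. (x, y) \<in> \<Union>C) xs ys"
  shows "\<exists>\<gamma>\<in>C. list_all2 (\<lambda>x y. (x, y) \<in> \<gamma>) xs ys"
  using assms(3)
proof (induction rule: list_all2_induct)
  case Nil
  then show ?case using assms(1) by auto
next
  case (Cons x xs y ys)
  then obtain \<alpha> \<beta> where "\<alpha> \<in> C" "(x, y) \<in> \<alpha>" "\<beta> \<in> C" "list_all2 (\<lambda>x y. (x, y) \<in> \<beta>) xs ys"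
    by auto
  moreover obtain \<gamma> where "\<gamma> \<in> C" "\<alpha> \<union> \<beta> \<subseteq> \<gamma>"
    using directed calculation by blast
  ultimately have "list_all2 (\<lambda>x y. (x, y) \<in> \<gamma>) (x # xs) (y # ys)"
    using list_all2_mono[of "\<lambda>x y. (x, y) \<in> \<beta>" xs ys "\<lambda>x y. (x, y) \<in> \<gamma>"] by auto
  then show ?case using \<open>\<gamma> \<in> C\<close> by blast
qed

lemma congruences_directed_Union:
  assumes "C \<noteq> {}" "C \<subseteq> congruences A"
    and directed: "\<And>\<alpha> \<beta>. \<lbrakk>\<alpha> \<in> C; \<beta> \<in> C\<rbrakk> \<Longrightarrow> \<exists>\<gamma>\<in>C. \<alpha> \<union> \<beta> \<subseteq> \<gamma>"
  shows "\<Union>C \<in> congruences A"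
proof (rule congruencesI)
  have eqv: "equiv (universe A) \<theta>" if "\<theta> \<in> C" for \<theta>
    using assms(2) congruences_equiv that by blast
  show "equiv (universe A) (\<Union>C)"
  proof (rule equivI)
    show "\<Union>C \<subseteq> universe A \<times> universe A"
      using eqv by (auto dest!: equiv_type)
    show "refl_on (universe A) (\<Union>C)"
      using assms(1) eqv by (fastforce simp: refl_on_def equiv_def)
    show "sym (\<Union>C)"
      using eqv by (auto simp: equiv_def intro!: symI dest: symD)
    show "trans (\<Union>C)"
    proof (rule transI)
      fix x y z
      assume "(x, y) \<in> \<Union>C" "(y, z) \<in> \<Union>C"
      then obtain \<gamma> where "\<gamma> \<in> C" "(x, y) \<in> \<gamma>" "(y, z) \<in> \<gamma>"
        using directed by blast
      then show "(x, z) \<in> \<Union>C"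
        using eqv[of \<gamma>] by (auto simp: equiv_def dest: transD)
    qed
  qed
next
  fix f xs ys
  assume f: "f \<in> symbols A" "xs \<in> arguments A f" "ys \<in> arguments A f"
    and *: "list_all2 (\<lambda>x y. (x, y) \<in> \<Union>C) xs ys"
  obtain \<gamma> where "\<gamma> \<in> C" "list_all2 (\<lambda>x y. (x, y) \<in> \<gamma>) xs ys"
    using directed_list_all2[OF assms(1) directed *] by blast
  then have "(operation A f xs, operation A f ys) \<in> \<gamma>"
    using f assms(2) by (intro congruences_operation) auto
  then show "(operation A f xs, operation A f ys) \<in> \<Union>C"
    using \<open>\<gamma> \<in> C\<close> by blast
qed

text \<open>The description denotes the unique extension when \<open>B\<close> is a
  congruence-preserving extension of \<open>A\<close> and \<open>\<alpha>\<close> is a congruence of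
  \<open>A\<close>.\<close>

definition con_ext :: "('f, 'a) algebra \<Rightarrow> ('f, 'a) algebra \<Rightarrow> 'a rel \<Rightarrow> 'a rel"
  where "con_ext A B \<alpha> = (THE \<beta>. \<beta> \<in> congruences B \<and> \<beta> \<inter> (universe A \<times> universe A) = \<alpha>)"

section \<open>Compatibility of \<open>con_ext\<close> with intersections and directed
  unions\<close>

context
  fixes A B :: "('f, 'a) algebra"
  assumes ext: "congruence_preserving_extension A B"
begin

lemma
  assumes "\<alpha> \<in> congruences A"
  shows con_ext_congruence: "con_ext A B \<alpha> \<in> congruences B"
    and con_ext_restrict: "con_ext A B \<alpha> \<inter> (universe A \<times> universe A) = \<alpha>"
proof -
  have "\<exists>!\<beta>. \<beta> \<in> congruences B \<and> \<beta> \<inter> (universe A \<times> universe A) = \<alpha>"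
    using ext assms by (simp add: congruence_preserving_extension_def)
  from theI'[OF this] show "con_ext A B \<alpha> \<in> congruences B"
    "con_ext A B \<alpha> \<inter> (universe A \<times> universe A) = \<alpha>"
    by (simp_all add: con_ext_def)
qed

lemma con_ext_unique:
  assumes "\<alpha> \<in> congruences A" "\<beta> \<in> congruences B" "\<beta> \<inter> (universe A \<times> universe A) = \<alpha>"
  shows "con_ext A B \<alpha> = \<beta>"
proof -
  have "\<exists>!\<beta>. \<beta> \<in> congruences B \<and> \<beta> \<inter> (universe A \<times> universe A) = \<alpha>"
    using ext assms(1) by (simp add: congruence_preserving_extension_def)
  with assms show ?thesis
    unfolding con_ext_def by (intro the1_equality) auto
qed

lemma subset_con_ext: "\<alpha> \<in> congruences A \<Longrightarrow> \<alpha> \<subseteq> con_ext A B \<alpha>"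
  using con_ext_restrict by blast

text \<open>The intersection of the extensions is a congruence of \<open>B\<close> that restricts to
  \<open>\<Inter>C\<close>, so uniqueness identifies it. Directed unions are treated below in the
  same way.\<close>

lemma con_ext_Inter:
  assumes "C \<noteq> {}" "C \<subseteq> congruences A"
  shows "con_ext A B (\<Inter>C) = \<Inter>(con_ext A B ` C)"
proof (rule con_ext_unique)
  show "\<Inter>(con_ext A B ` C) \<in> congruences B"
    using assms con_ext_congruence by (intro congruences_Inter) auto
  have "\<Inter>(con_ext A B ` C) \<inter> (universe A \<times> universe A)
      = \<Inter>((\<lambda>\<alpha>. con_ext A B \<alpha> \<inter> (universe A \<times> universe A)) ` C)"
    using assms(1) by auto
  also have "(\<lambda>\<alpha>. con_ext A B \<alpha> \<inter> (universe A \<times> universe A)) ` C = C"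
    using assms(2) con_ext_restrict by (auto simp: subset_iff image_iff)
  finally show "\<Inter>(con_ext A B ` C) \<inter> (universe A \<times> universe A) = \<Inter>C" .
qed (use assms congruences_Inter in auto)

lemma con_ext_mono:
  assumes "\<alpha> \<in> congruences A" "\<beta> \<in> congruences A" "\<alpha> \<subseteq> \<beta>"
  shows "con_ext A B \<alpha> \<subseteq> con_ext A B \<beta>"
proof -
  have "\<alpha> = \<Inter>{\<alpha>, \<beta>}" using assms by auto
  then show ?thesis using con_ext_Inter[of "{\<alpha>, \<beta>}"] assms by auto
qed

lemma con_ext_directed_Union:
  assumes "C \<noteq> {}" "C \<subseteq> congruences A"
    and directed: "\<And>\<alpha> \<beta>. \<lbrakk>\<alpha> \<in> C; \<beta> \<in> C\<rbrakk> \<Longrightarrow> \<exists>\<gamma>\<in>C. \<alpha> \<union> \<beta> \<subseteq> \<gamma>"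
  shows "con_ext A B (\<Union>C) = \<Union>(con_ext A B ` C)"
proof (rule con_ext_unique)
  show "\<Union>(con_ext A B ` C) \<in> congruences B"
  proof (rule congruences_directed_Union)
    fix \<alpha>' \<beta>'
    assume "\<alpha>' \<in> con_ext A B ` C" "\<beta>' \<in> con_ext A B ` C"
    then obtain \<alpha> \<beta> where "\<alpha> \<in> C" "\<beta> \<in> C" "\<alpha>' = con_ext A B \<alpha>" "\<beta>' = con_ext A B \<beta>"
      by auto
    moreover obtain \<gamma> where "\<gamma> \<in> C" "\<alpha> \<union> \<beta> \<subseteq> \<gamma>"
      using directed calculation by blast
    ultimately show "\<exists>\<gamma>'\<in>con_ext A B ` C. \<alpha>' \<union> \<beta>' \<subseteq> \<gamma>'"
      using con_ext_mono[of _ \<gamma>] assms(2) by (intro bexI[of _ "con_ext A B \<gamma>"]) auto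
  qed (use assms con_ext_congruence in auto)
  have "\<Union>(con_ext A B ` C) \<inter> (universe A \<times> universe A)
      = \<Union>((\<lambda>\<alpha>. con_ext A B \<alpha> \<inter> (universe A \<times> universe A)) ` C)"
    by auto
  also have "(\<lambda>\<alpha>. con_ext A B \<alpha> \<inter> (universe A \<times> universe A)) ` C = C"
    using assms(2) con_ext_restrict by (auto simp: subset_iff image_iff)
  finally show "\<Union>(con_ext A B ` C) \<inter> (universe A \<times> universe A) = \<Union>C" .
qed (rule congruences_directed_Union[OF assms])

end

section \<open>Sublattices and copies\<close>

text \<open>Joins and meets are derived from the order, so only the order is transported. With
  \<open>g = id\<close> this gives sublattices; with \<open>g\<close> inverse to an injection it
  gives copies on another type.\<close>

definition pullback_order :: "'b set \<Rightarrow> ('b \<Rightarrow> 'a) \<Rightarrow> 'a gorder \<Rightarrow> 'b gorder"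
  where "pullback_order Y g M = \<lparr>carrier = Y, eq = (=), le = (\<lambda>x y. g x \<sqsubseteq>\<^bsub>M\<^esub> g y)\<rparr>"

lemma carrier_pullback_order [simp]: "carrier (pullback_order Y g M) = Y"
  by (simp add: pullback_order_def)

lemma le_pullback_order [simp]: "x \<sqsubseteq>\<^bsub>pullback_order Y g M\<^esub> y \<longleftrightarrow> g x \<sqsubseteq>\<^bsub>M\<^esub> g y"
  by (simp add: pullback_order_def)

lemma (in lattice) join_eqI: "least L s (Upper L {x, y}) \<Longrightarrow> x \<squnion> y = s"
  using weak_least_unique someI[of "\<lambda>s. least L s (Upper L {x, y})" s]
  by (simp add: join_def sup_def eq_is_equal)

lemma (in lattice) meet_eqI: "greatest L s (Lower L {x, y}) \<Longrightarrow> x \<sqinter> y = s"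
  using weak_greatest_unique someI[of "\<lambda>s. greatest L s (Lower L {x, y})" s]
  by (simp add: meet_def inf_def eq_is_equal)

locale lattice_pullback = lattice M
  for M :: "'a gorder" +
  fixes Y :: "'b set" and g :: "'b \<Rightarrow> 'a"
  assumes inj: "inj_on g Y" and into: "g ` Y \<subseteq> carrier M"
    and join_in: "\<lbrakk>x \<in> Y; y \<in> Y\<rbrakk> \<Longrightarrow> g x \<squnion>\<^bsub>M\<^esub> g y \<in> g ` Y"
    and meet_in: "\<lbrakk>x \<in> Y; y \<in> Y\<rbrakk> \<Longrightarrow> g x \<sqinter>\<^bsub>M\<^esub> g y \<in> g ` Y"
begin

abbreviation "P \<equiv> pullback_order Y g M"

lemma carrierI: "x \<in> Y \<Longrightarrow> g x \<in> carrier M"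
  using into by auto

lemma least_join:
  assumes "x \<in> Y" "y \<in> Y" "s \<in> Y" "g s = g x \<squnion>\<^bsub>M\<^esub> g y"
  shows "least P s (Upper P {x, y})"
  using assms carrierI by (auto simp: least_def Upper_def join_left join_right join_le)

lemma greatest_meet:
  assumes "x \<in> Y" "y \<in> Y" "s \<in> Y" "g s = g x \<sqinter>\<^bsub>M\<^esub> g y"
  shows "greatest P s (Lower P {x, y})"
  using assms carrierI by (auto simp: greatest_def Lower_def meet_left meet_right meet_le)

lemma partial_order: "partial_order P"
proof
  show "(.=\<^bsub>P\<^esub>) = (=)"
    by (simp add: pullback_order_def)
  then show "x .=\<^bsub>P\<^esub> y" if "x \<sqsubseteq>\<^bsub>P\<^esub> y" "y \<sqsubseteq>\<^bsub>P\<^esub> x" "x \<in> carrier P" "y \<in> carrier P" for x y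
    using that carrierI le_antisym inj by (auto simp: inj_on_def)
qed (use carrierI in \<open>auto simp: pullback_order_def intro: le_trans\<close>)

lemma lattice: "lattice P"
proof -
  interpret P: partial_order P by (rule partial_order)
  show ?thesis
  proof
    fix x y
    assume xy: "x \<in> carrier P" "y \<in> carrier P"
    obtain s where "s \<in> Y" "g s = g x \<squnion>\<^bsub>M\<^esub> g y"
      using join_in[of x y] xy by auto
    then show "\<exists>s. is_lub P s {x, y}"
      using least_join[of x y s] xy by auto
    obtain s where "s \<in> Y" "g s = g x \<sqinter>\<^bsub>M\<^esub> g y"
      using meet_in[of x y] xy by auto
    then show "\<exists>s. is_glb P s {x, y}"
      using greatest_meet[of x y s] xy by auto
  qed
qed

lemma join: "g (x \<squnion>\<^bsub>P\<^esub> y) = g x \<squnion>\<^bsub>M\<^esub> g y" if xy: "x \<in> Y" "y \<in> Y"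
proof -
  interpret P: lattice P by (rule lattice)
  obtain s where "s \<in> Y" "g s = g x \<squnion>\<^bsub>M\<^esub> g y"
    using join_in[OF xy] by auto
  with P.join_eqI[OF least_join[OF xy this]] show ?thesis by simp
qed

lemma meet: "g (x \<sqinter>\<^bsub>P\<^esub> y) = g x \<sqinter>\<^bsub>M\<^esub> g y" if xy: "x \<in> Y" "y \<in> Y"
proof -
  interpret P: lattice P by (rule lattice)
  obtain s where "s \<in> Y" "g s = g x \<sqinter>\<^bsub>M\<^esub> g y"
    using meet_in[OF xy] by auto
  with P.meet_eqI[OF greatest_meet[OF xy this]] show ?thesis by simp
qed

lemma eval_term_pullback:
  assumes "range v \<subseteq> Y"
  shows "eval_term P v t \<in> Y \<and> g (eval_term P v t) = eval_term M (g \<circ> v) t"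
proof -
  interpret P: lattice P by (rule lattice)
  show ?thesis
    using assms P.join_closed P.meet_closed
    by (induction t) (auto simp: join meet)
qed

text \<open>Identities pass to \<open>P\<close> because \<open>g\<close> is injective and commutes
  with term evaluation.\<close>

lemma variety:
  assumes "M \<in> variety E" "Y \<noteq> {}"
  shows "P \<in> variety E"
  unfolding variety_def
proof (clarsimp simp: lattice assms(2))
  fix s t and v :: "nat \<Rightarrow> 'b"
  assume st: "(s, t) \<in> E" and v: "range v \<subseteq> Y"
  have "range (g \<circ> v) \<subseteq> carrier M"
    using v carrierI by auto
  then have "eval_term M (g \<circ> v) s = eval_term M (g \<circ> v) t"
    using assms(1) st by (fastforce simp: variety_def)
  then show "eval_term P v s = eval_term P v t"
    using eval_term_pullback[OF v] inj by (metis inj_on_def)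
qed

lemma bounded_lattice:
  assumes "b \<in> Y" "t \<in> Y" "\<And>x. x \<in> Y \<Longrightarrow> g b \<sqsubseteq>\<^bsub>M\<^esub> g x \<and> g x \<sqsubseteq>\<^bsub>M\<^esub> g t"
  shows "bounded_lattice P" "\<bottom>\<^bsub>P\<^esub> = b" "\<top>\<^bsub>P\<^esub> = t"
proof -
  interpret P: lattice P by (rule lattice)
  show bl: "bounded_lattice P"
    by unfold_locales (use assms in \<open>auto simp: least_def greatest_def\<close>)
  then interpret P: bounded_lattice P .
  show "\<bottom>\<^bsub>P\<^esub> = b" "\<top>\<^bsub>P\<^esub> = t"
    using P.bottom_eq[of b] P.top_eq[of t] assms by auto
qed

end

section \<open>Free pairs\<close>

text \<open>This is the case of pairs in Kuratowski's free set theorem. A countably infinite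
  \<open>Y\<close> and its images under \<open>f\<close> leave some \<open>x\<close> uncovered, and
  the finite set \<open>f x\<close> cannot contain all of \<open>Y\<close>.\<close>

lemma uncountable_free_pair:
  assumes "uncountable X" "\<And>x. x \<in> X \<Longrightarrow> finite (f x)"
  obtains x y where "x \<in> X" "y \<in> X" "x \<noteq> y" "x \<notin> f y" "y \<notin> f x"
proof -
  obtain Y where Y: "Y \<subseteq> X" "countable Y" "infinite Y"
    using infinite_countable_subset'[OF uncountable_infinite[OF assms(1)]] by metis
  have "countable (Y \<union> (\<Union>y\<in>Y. f y))"
    using Y assms(2) by (intro countable_Un countable_UN) (auto intro: countable_finite)
  then have "\<not> X \<subseteq> Y \<union> (\<Union>y\<in>Y. f y)"
    using assms(1) countable_subset by blast
  then obtain x where x: "x \<in> X" "x \<notin> Y" "\<And>y. y \<in> Y \<Longrightarrow> x \<notin> f y"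
    by blast
  have "\<not> Y \<subseteq> f x"
    using assms(2)[OF x(1)] Y(3) finite_subset by blast
  then obtain y where "y \<in> Y" "y \<notin> f x" by blast
  with x Y(1) show ?thesis by (intro that[of x y]) auto
qed

section \<open>Kernels of lattice homomorphisms\<close>

definition lattice_congruence :: "'a gorder \<Rightarrow> 'a rel \<Rightarrow> bool"
  where "lattice_congruence F \<theta> \<longleftrightarrow> equiv (carrier F) \<theta> \<and>
    (\<forall>a b c d. (a, b) \<in> \<theta> \<longrightarrow> (c, d) \<in> \<theta> \<longrightarrow>
      (a \<squnion>\<^bsub>F\<^esub> c, b \<squnion>\<^bsub>F\<^esub> d) \<in> \<theta> \<and> (a \<sqinter>\<^bsub>F\<^esub> c, b \<sqinter>\<^bsub>F\<^esub> d) \<in> \<theta>)"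

definition lattice_kernel :: "'a gorder \<Rightarrow> ('a \<Rightarrow> 'b) \<Rightarrow> 'a rel"
  where "lattice_kernel F h = {(a, b). a \<in> carrier F \<and> b \<in> carrier F \<and> h a = h b}"

text \<open>Stated for bare binary operations \<open>j\<close> and \<open>m\<close>, so that it
  covers homomorphisms as well as the maps \<open>h a \<sqinter> w\<close> that project a
  square.\<close>

lemma lattice_congruence_kernel:
  assumes "lattice F"
    and "\<And>a b. \<lbrakk>a \<in> carrier F; b \<in> carrier F\<rbrakk> \<Longrightarrow> h (a \<squnion>\<^bsub>F\<^esub> b) = j (h a) (h b)"
    and "\<And>a b. \<lbrakk>a \<in> carrier F; b \<in> carrier F\<rbrakk> \<Longrightarrow> h (a \<sqinter>\<^bsub>F\<^esub> b) = m (h a) (h b)"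
  shows "lattice_congruence F (lattice_kernel F h)"
proof -
  interpret lattice F by fact
  show ?thesis
    using assms(2-)
    by (auto simp: lattice_congruence_def lattice_kernel_def equiv_def refl_on_def intro: symI transI)
qed

lemma arguments_0_2:
  "arity A f = 0 \<Longrightarrow> xs \<in> arguments A f \<longleftrightarrow> xs = []"
  "arity A f = 2 \<Longrightarrow> xs \<in> arguments A f \<longleftrightarrow> (\<exists>x y. xs = [x, y] \<and> x \<in> universe A \<and> y \<in> universe A)"
  by (auto simp: arguments_def numeral_2_eq_2 length_Suc_conv)


lemma lattice_congruence_lattice_algebra:
  assumes "lattice_congruence F \<theta>"
  shows "\<theta> \<in> congruences (lattice_algebra F)"
  using assms
  by (intro congruencesI)
    (auto simp: lattice_congruence_def lattice_algebra_def arguments_0_2)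

text \<open>A nullary symbol asks only for reflexivity at its value, so the two bounds add no
  constraint.\<close>

lemma lattice_congruence_bounded_lattice_algebra:
  assumes "bounded_lattice F" "lattice_congruence F \<theta>"
  shows "\<theta> \<in> congruences (bounded_lattice_algebra F)"
proof -
  interpret bounded_lattice F by fact
  have "(\<bottom>\<^bsub>F\<^esub>, \<bottom>\<^bsub>F\<^esub>) \<in> \<theta>" "(\<top>\<^bsub>F\<^esub>, \<top>\<^bsub>F\<^esub>) \<in> \<theta>"
    using assms(2) by (auto simp: lattice_congruence_def equiv_def refl_on_def)
  then show ?thesis
    using assms
    by (intro congruencesI)
      (auto simp: lattice_congruence_def bounded_lattice_algebra_def arguments_0_2)
qed

section \<open>Free objects\<close>

lemma lattice_homD:
  assumes "h \<in> lattice_hom L K" "x \<in> carrier L"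
  shows "h x \<in> carrier K"
    and "y \<in> carrier L \<Longrightarrow> h (x \<squnion>\<^bsub>L\<^esub> y) = h x \<squnion>\<^bsub>K\<^esub> h y"
    and "y \<in> carrier L \<Longrightarrow> h (x \<sqinter>\<^bsub>L\<^esub> y) = h x \<sqinter>\<^bsub>K\<^esub> h y"
  using assms by (auto simp: lattice_hom_def)

lemma free_object_hom_unique:
  assumes "free_object C Hom X F" "X \<subseteq> carrier F" "L \<in> C" "g \<in> Hom F L" "h \<in> Hom F L"
    and "g ` X \<subseteq> carrier L" "\<And>x. x \<in> X \<Longrightarrow> g x = h x"
  shows "g = h"
proof -
  have "g \<in> X \<rightarrow> carrier L" using assms by auto
  then have "\<exists>!k. k \<in> Hom F L \<and> (\<forall>x\<in>X. k x = g x)"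
    using assms(1,3) unfolding free_object_def by blast
  then show ?thesis using assms(4,5,7) by metis
qed

text \<open>
  The subalgebra generated by \<open>X\<close> receives a homomorphism from \<open>F\<close> that fixes \<open>X\<close>;
  followed by the inclusion it must be the identity of \<open>F\<close>.
\<close>

lemma free_lattice_induct:
  assumes free: "free_object (variety E) lattice_hom X F" and "X \<noteq> {}" and "a \<in> carrier F"
    and gen: "\<And>x. x \<in> X \<Longrightarrow> Q x"
    and join: "\<And>a b. \<lbrakk>a \<in> carrier F; b \<in> carrier F; Q a; Q b\<rbrakk> \<Longrightarrow> Q (a \<squnion>\<^bsub>F\<^esub> b)"
    and meet: "\<And>a b. \<lbrakk>a \<in> carrier F; b \<in> carrier F; Q a; Q b\<rbrakk> \<Longrightarrow> Q (a \<sqinter>\<^bsub>F\<^esub> b)"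
  shows "Q a"
proof -
  have F: "F \<in> variety E" "X \<subseteq> carrier F" "lattice F"
    using free by (auto simp: free_object_def variety_def)
  then interpret lattice F by simp
  define Y where "Y = {a \<in> carrier F. Q a}"
  interpret lattice_pullback F Y id
    by unfold_locales (auto simp: Y_def join meet)
  have XY: "X \<subseteq> Y"
    using F gen by (auto simp: Y_def)
  then have "P \<in> variety E"
    using F \<open>X \<noteq> {}\<close> by (intro variety) auto
  moreover have "id \<in> X \<rightarrow> carrier P"
    using XY by auto
  ultimately obtain h where h: "h \<in> lattice_hom F P" "\<And>x. x \<in> X \<Longrightarrow> h x = x"
    using free by (fastforce simp: free_object_def)
  have sub: "h \<in> lattice_hom F F"
    using h lattice_pullback.join[OF lattice_pullback_axioms]
      lattice_pullback.meet[OF lattice_pullback_axioms] 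
    by (auto simp: lattice_hom_def Y_def PiE_iff)
  \<comment> \<open>Members of \<open>lattice_hom\<close> are extensional functions, hence the
    restriction of \<open>id\<close>.\<close>
  have ident: "restrict id (carrier F) \<in> lattice_hom F F"
    by (auto simp: lattice_hom_def)
  have "h = restrict id (carrier F)"
    by (rule free_object_hom_unique[OF free F(2) F(1) sub ident]) (use h F in auto)
  then have "a \<in> Y"
    using lattice_homD(1)[OF h(1) \<open>a \<in> carrier F\<close>] \<open>a \<in> carrier F\<close> by auto
  then show ?thesis by (simp add: Y_def)
qed

text \<open>As in the unbounded case; since \<open>Q\<close> holds at the bounds of
  \<open>F\<close>, the sublattice has the same bounds and its inclusion preserves them.\<close>

lemma free_bounded_lattice_induct:
  assumes free: "free_object (bounded_variety E) bounded_lattice_hom X F" and "a \<in> carrier F"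
    and gen: "\<And>x. x \<in> X \<Longrightarrow> Q x" and bounds: "Q \<bottom>\<^bsub>F\<^esub>" "Q \<top>\<^bsub>F\<^esub>"
    and join: "\<And>a b. \<lbrakk>a \<in> carrier F; b \<in> carrier F; Q a; Q b\<rbrakk> \<Longrightarrow> Q (a \<squnion>\<^bsub>F\<^esub> b)"
    and meet: "\<And>a b. \<lbrakk>a \<in> carrier F; b \<in> carrier F; Q a; Q b\<rbrakk> \<Longrightarrow> Q (a \<sqinter>\<^bsub>F\<^esub> b)"
  shows "Q a"
proof -
  have F: "F \<in> bounded_variety E" "F \<in> variety E" "X \<subseteq> carrier F" "bounded_lattice F"
    using free by (auto simp: free_object_def bounded_variety_def)
  then interpret bounded_lattice F by simp
  define Y where "Y = {a \<in> carrier F. Q a}"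
  interpret lattice_pullback F Y id
    by unfold_locales (auto simp: Y_def join meet)
  have XY: "X \<subseteq> Y"
    using F gen by (auto simp: Y_def)
  have bd: "bounded_lattice P" "\<bottom>\<^bsub>P\<^esub> = \<bottom>\<^bsub>F\<^esub>" "\<top>\<^bsub>P\<^esub> = \<top>\<^bsub>F\<^esub>"
    using bounded_lattice[of "\<bottom>\<^bsub>F\<^esub>" "\<top>\<^bsub>F\<^esub>"] bounds by (auto simp: Y_def)
  have "P \<in> variety E"
    using F bounds by (intro variety) (auto simp: Y_def)
  then have "P \<in> bounded_variety E"
    using bd by (simp add: bounded_variety_def)
  moreover have "id \<in> X \<rightarrow> carrier P"
    using XY by auto
  ultimately obtain h where h: "h \<in> bounded_lattice_hom F P" "\<And>x. x \<in> X \<Longrightarrow> h x = x"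
    using free by (fastforce simp: free_object_def)
  have sub: "h \<in> bounded_lattice_hom F F"
    using h bd lattice_pullback.join[OF lattice_pullback_axioms]
      lattice_pullback.meet[OF lattice_pullback_axioms] 
    by (auto simp: bounded_lattice_hom_def lattice_hom_def Y_def PiE_iff)
  have ident: "restrict id (carrier F) \<in> bounded_lattice_hom F F"
    by (auto simp: bounded_lattice_hom_def lattice_hom_def)
  have "h = restrict id (carrier F)"
    by (rule free_object_hom_unique[OF free F(3) F(1) sub ident]) (use h F in auto)
  then have "a \<in> Y"
    using h(1) \<open>a \<in> carrier F\<close> lattice_homD(1)[of h F P a]
    by (auto simp: bounded_lattice_hom_def)
  then show ?thesis by (simp add: Y_def)
qed

section \<open>Squares\<close>

text \<open>The elements \<open>u\<close>, \<open>r\<close>, \<open>c\<close>, \<open>v\<close> form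
  a possibly degenerate copy of the four-element Boolean lattice, whose two projections are the
  meets with \<open>r\<close> and with \<open>c\<close>.\<close>

locale lattice_square = lattice K
  for K :: "'a gorder" (structure) +
  fixes r c u v
  assumes rc [simp]: "r \<in> carrier K" "c \<in> carrier K"
    and meet_rc: "r \<sqinter> c = u" and join_rc: "r \<squnion> c = v"
begin

lemma bounds_closed [simp]: "u \<in> carrier K" "v \<in> carrier K"
  using meet_rc join_rc rc by auto

lemma square_le: "u \<sqsubseteq> r" "u \<sqsubseteq> c" "r \<sqsubseteq> v" "c \<sqsubseteq> v" "u \<sqsubseteq> v"
  using rc unfolding meet_rc[symmetric] join_rc[symmetric]
  by (auto intro: meet_left meet_right join_left join_right le_trans[OF meet_left join_left])

lemma absorb:
  assumes "x \<in> carrier K" "y \<in> carrier K" "x \<sqsubseteq> y"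
  shows "x \<squnion> y = y" "y \<squnion> x = y" "x \<sqinter> y = x" "y \<sqinter> x = x"
  using assms le_iff_join[of x y] le_iff_meet[of x y]
  by (auto simp: join_comm[of K y x] meet_comm[of K y x])

lemma square_table:
  "u \<squnion> u = u" "u \<squnion> r = r" "u \<squnion> c = c" "u \<squnion> v = v" "r \<squnion> u = r" "r \<squnion> r = r" "r \<squnion> c = v" "r \<squnion> v = v"
  "c \<squnion> u = c" "c \<squnion> r = v" "c \<squnion> c = c" "c \<squnion> v = v" "v \<squnion> u = v" "v \<squnion> r = v" "v \<squnion> c = v" "v \<squnion> v = v"
  "u \<sqinter> u = u" "u \<sqinter> r = u" "u \<sqinter> c = u" "u \<sqinter> v = u" "r \<sqinter> u = u" "r \<sqinter> r = r" "r \<sqinter> c = u" "r \<sqinter> v = r"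
  "c \<sqinter> u = u" "c \<sqinter> r = u" "c \<sqinter> c = c" "c \<sqinter> v = c" "v \<sqinter> u = u" "v \<sqinter> r = r" "v \<sqinter> c = c" "v \<sqinter> v = v"
  using square_le by (simp_all add: absorb meet_rc join_rc join_comm[of K c r] meet_comm[of K c r])

lemma square_closed:
  assumes "s \<in> {u, r, c, v}" "t \<in> {u, r, c, v}"
  shows "s \<squnion> t \<in> {u, r, c, v}" "s \<sqinter> t \<in> {u, r, c, v}"
  using assms by (auto simp: square_table)

text \<open>Projections respect both operations on the square; this makes their kernels congruences
  even though \<open>K\<close> is not distributive.\<close>

lemma square_distrib:
  assumes "w \<in> {r, c}" "s \<in> {u, r, c, v}" "t \<in> {u, r, c, v}"
  shows "(s \<squnion> t) \<sqinter> w = (s \<sqinter> w) \<squnion> (t \<sqinter> w)" "(s \<sqinter> t) \<sqinter> w = (s \<sqinter> w) \<sqinter> (t \<sqinter> w)"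
  using assms by (auto simp: square_table)

lemma square_eqI:
  assumes "s \<in> {u, r, c, v}" "t \<in> {u, r, c, v}" "s \<sqinter> r = t \<sqinter> r" "s \<sqinter> c = t \<sqinter> c"
  shows "s = t"
  using assms square_table by auto

end

section \<open>The permutability obstruction\<close>

text \<open>The set \<open>H\<close> stands for the plain or the bounded homomorphisms, so one
  argument serves both cases. \<open>extend\<close> is the universal property, while
  \<open>support\<close> and \<open>range\<close> express generation by \<open>X\<close>; in
  \<open>range\<close>, \<open>u\<close> and \<open>v\<close> account for possible
  constants.\<close>

lemma no_permutable_extension:
  fixes F :: "'a gorder" and K :: "'b gorder" (structure) and A B :: "('f, 'a) algebra"
  assumes lattices: "lattice F" "lattice K" and X: "X \<subseteq> carrier F" "uncountable X"
    and H: "H \<subseteq> lattice_hom F K"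
    and extend: "\<And>f. f \<in> X \<rightarrow> carrier K \<Longrightarrow> \<exists>h\<in>H. \<forall>x\<in>X. h x = f x"
    and support: "\<And>a. a \<in> carrier F \<Longrightarrow>
      \<exists>S\<subseteq>X. finite S \<and> (\<forall>g\<in>H. \<forall>h\<in>H. (\<forall>x\<in>S. g x = h x) \<longrightarrow> g a = h a)"
    and range: "\<And>h Y. \<lbrakk>h \<in> H; h ` X \<subseteq> Y; u \<in> Y; v \<in> Y; Y \<subseteq> carrier K;
      \<And>s t. \<lbrakk>s \<in> Y; t \<in> Y\<rbrakk> \<Longrightarrow> s \<squnion> t \<in> Y \<and> s \<sqinter> t \<in> Y\<rbrakk> \<Longrightarrow> h ` carrier F \<subseteq> Y"
    and A: "universe A = carrier F" "\<And>\<theta>. lattice_congruence F \<theta> \<Longrightarrow> \<theta> \<in> congruences A"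
    and pqr: "p \<in> carrier K" "q \<in> carrier K" "r \<in> carrier K" "p \<noteq> q"
      "r \<sqinter> p = u" "r \<sqinter> q = u" "r \<squnion> p = v" "r \<squnion> q = v"
    and ext: "congruence_preserving_extension A B"
  shows "\<not> congruence_permutable B"
proof
  assume perm: "congruence_permutable B"
  interpret F: lattice F by fact
  interpret K: lattice K by fact
  have square: "lattice_square K r c u v" if "c \<in> {p, q}" for c
    using that pqr by unfold_locales auto
  have uv: "u \<in> carrier K" "v \<in> carrier K"
    using pqr by auto
  have inf: "infinite X" using X(2) uncountable_infinite by blast
  obtain a0 where a0: "a0 \<in> X" using inf by fastforce
  obtain a1 where a1: "a1 \<in> X" "a1 \<noteq> a0"
    using inf finite_subset[of X "{a0}"] by auto
  obtain a2 where a2: "a2 \<in> X" "a2 \<noteq> a0" "a2 \<noteq> a1"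
    using inf finite_subset[of X "{a0, a1}"] by auto

  \<comment> \<open>Admissible homomorphisms and the congruences they define\<close>
  define Z where "Z = X - {a0, a1, a2}"
  have Z: "uncountable Z" "Z \<subseteq> X"
    using X(2) by (auto simp: Z_def uncountable_minus_countable)
  \<comment> \<open>\<open>adm c x X h\<close> says that \<open>h\<close> is the map into the square of \<open>c\<close> given by \<open>x\<close>; for
    smaller \<open>S\<close> the values outside \<open>S\<close> are arbitrary.\<close>
  define adm where "adm c x S h \<longleftrightarrow> h \<in> H \<and> h x = c \<and> h a0 = u \<and> h a1 = r \<and> h a2 = v \<and>
      (\<forall>y\<in>S - {x, a0, a1, a2}. h y = u)" for c x S h
  have ex_adm: "\<exists>h. adm c x X h" if "c \<in> {p, q}" "x \<in> Z" for c x
  proof -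
    have "(\<lambda>y. if y = x then c else if y = a1 then r else if y = a2 then v else u) \<in> X \<rightarrow> carrier K"
      using that pqr uv by auto
    from extend[OF this] obtain h where h: "h \<in> H"
      "\<And>y. y \<in> X \<Longrightarrow> h y = (if y = x then c else if y = a1 then r else if y = a2 then v else u)"
      by blast
    then have "adm c x X h"
      using a0 a1 a2 that by (auto simp: adm_def Z_def)
    then show ?thesis by blast
  qed
  have adm_mono: "adm c x T h" if "adm c x S h" "T \<subseteq> S" for c x S T h
    using that by (auto simp: adm_def)
  have adm_hom: "h \<in> lattice_hom F K" if "adm c x S h" for c x S h
    using that H by (auto simp: adm_def)
  have adm_range: "h a \<in> {u, r, c, v}" if "adm c x X h" "c \<in> {p, q}" "a \<in> carrier F" for c x h a
  proof -
    interpret lattice_square K r c u v using square that by blast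
    have "h ` X \<subseteq> {u, r, c, v}"
      using that(1) by (auto simp: adm_def)
    then have "h ` carrier F \<subseteq> {u, r, c, v}"
      using that(1) square_closed by (intro range) (auto simp: adm_def)
    then show ?thesis using that(3) by blast
  qed
  \<comment> \<open>Intersecting over both values of \<open>c\<close> lets the same \<open>t\<close>
    serve later for a generator sent to \<open>p\<close> and for one sent to
    \<open>q\<close>.\<close>
  define \<kappa>\<^sub>1 where "\<kappa>\<^sub>1 x = \<Inter>{lattice_kernel F (\<lambda>a. h a \<sqinter> r) | c h. c \<in> {p, q} \<and> adm c x X h}" for x
  define \<kappa>\<^sub>2 where "\<kappa>\<^sub>2 x = \<Inter>{lattice_kernel F (\<lambda>a. h a \<sqinter> c) | c h. c \<in> {p, q} \<and> adm c x X h}" for x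
  define \<Lambda> where "\<Lambda> x S = \<Inter>{lattice_kernel F h | c h. c \<in> {p, q} \<and> adm c x S h}" for x S
  have square_kernel: "lattice_kernel F (\<lambda>a. h a \<sqinter> w) \<in> congruences A"
    if "c \<in> {p, q}" "adm c x X h" "w \<in> {r, c}" for c x h w
  proof -
    interpret lattice_square K r c u v using square that by blast
    show ?thesis
      using that square_distrib[of w] adm_range[OF that(2,1)] lattice_homD[OF adm_hom[OF that(2)]]
      by (intro A(2) lattice_congruence_kernel[OF lattices(1), where j = "join K" and m = "meet K"]) simp_all
  qed
  have hom_kernel: "lattice_kernel F h \<in> congruences A" if "adm c x S h" for c x S h
    using lattice_homD[OF adm_hom[OF that]]
    by (intro A(2) lattice_congruence_kernel[OF lattices(1), where j = "join K" and m = "meet K"]) simp_all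
  have \<kappa>: "\<kappa>\<^sub>1 x \<in> congruences A" "\<kappa>\<^sub>2 x \<in> congruences A" if "x \<in> Z" for x
    unfolding \<kappa>\<^sub>1_def \<kappa>\<^sub>2_def using ex_adm[of p x] that square_kernel
    by (intro congruences_Inter; blast)+
  have \<Lambda>: "\<Lambda> x S \<in> congruences A" if x: "x \<in> Z" and S: "S \<subseteq> X" for x S
    unfolding \<Lambda>_def
  proof (rule congruences_Inter)
    obtain h where "adm p x X h"
      using ex_adm[of p x] x by blast
    then have "adm p x S h"
      using adm_mono S by blast
    then show "{lattice_kernel F h | c h. c \<in> {p, q} \<and> adm c x S h} \<noteq> {}"
      by blast
  qed (use hom_kernel in blast)
  \<comment> \<open>A larger set admits fewer \<open>h\<close>, so fewer kernels are
    intersected.\<close>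
  have \<Lambda>_mono: "\<Lambda> x S \<subseteq> \<Lambda> x T" if "S \<subseteq> T" for x S T
    unfolding \<Lambda>_def using adm_mono[OF _ that] by blast

  have \<kappa>_subset: "\<kappa>\<^sub>1 x \<inter> \<kappa>\<^sub>2 x \<subseteq> \<Union>{\<Lambda> x S | S. S \<subseteq> X \<and> finite S}" if x: "x \<in> Z" for x
  proof (rule subrelI)
    fix a b
    assume ab: "(a, b) \<in> \<kappa>\<^sub>1 x \<inter> \<kappa>\<^sub>2 x"
    then have F_ab: "a \<in> carrier F" "b \<in> carrier F"
      using congruences_equiv[OF \<kappa>(1)[OF x]] A(1) equiv_type by blast+
    have eq: "h a = h b" if h: "adm c x X h" "c \<in> {p, q}" for c h
    proof -
      interpret lattice_square K r c u v using square h by blast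
      have "(a, b) \<in> lattice_kernel F (\<lambda>a. h a \<sqinter> r)" "(a, b) \<in> lattice_kernel F (\<lambda>a. h a \<sqinter> c)"
        using ab h unfolding \<kappa>\<^sub>1_def \<kappa>\<^sub>2_def by blast+
      then show ?thesis
        by (intro square_eqI[OF adm_range[OF h F_ab(1)] adm_range[OF h F_ab(2)]])
          (simp_all add: lattice_kernel_def)
    qed
    obtain S T where S: "S \<subseteq> X" "finite S"
        "\<And>g h. \<lbrakk>g \<in> H; h \<in> H; \<forall>x\<in>S. g x = h x\<rbrakk> \<Longrightarrow> g a = h a"
      and T: "T \<subseteq> X" "finite T"
        "\<And>g h. \<lbrakk>g \<in> H; h \<in> H; \<forall>x\<in>T. g x = h x\<rbrakk> \<Longrightarrow> g b = h b"
      using support[OF F_ab(1)] support[OF F_ab(2)] by metis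
    \<comment> \<open>The values at \<open>a\<close> and \<open>b\<close> depend only on
      \<open>S \<union> T\<close>. There \<open>h\<close> agrees with a map \<open>g\<close>
      admissible for all of \<open>X\<close>, and \<open>g\<close> identifies \<open>a\<close> with
      \<open>b\<close>.\<close>
    have "(a, b) \<in> lattice_kernel F h" if h: "adm c x (S \<union> T) h" "c \<in> {p, q}" for c h
    proof -
      obtain g where g: "adm c x X g" using ex_adm h x by blast
      have "g y = h y" if "y \<in> S \<union> T" for y
      proof -
        have "y \<in> X" using that S T by auto
        then show ?thesis using that g h by (cases "y \<in> {x, a0, a1, a2}") (auto simp: adm_def)
      qed
      then have "g a = h a" "g b = h b"
        using S(3)[of g h] T(3)[of g h] g h by (auto simp: adm_def)
      then show ?thesis
        using eq[OF g h(2)] F_ab by (simp add: lattice_kernel_def)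
    qed
    then have "(a, b) \<in> \<Lambda> x (S \<union> T)"
      unfolding \<Lambda>_def by blast
    then show "(a, b) \<in> \<Union>{\<Lambda> x S | S. S \<subseteq> X \<and> finite S}"
      using S(1,2) T(1,2) by (intro UnionI[of "\<Lambda> x (S \<union> T)"]) auto
  qed

  \<comment> \<open>Finite supports for pairs in the extension\<close>
  define E where "E = con_ext A B"
  have finite_support: "\<exists>S. S \<subseteq> X \<and> finite S \<and> (t, x) \<in> E (\<Lambda> x S)"
    if x: "x \<in> Z" and tx: "(t, x) \<in> E (\<kappa>\<^sub>1 x)" "(t, x) \<in> E (\<kappa>\<^sub>2 x)" for t x
  proof -
    define C where "C = {\<Lambda> x S | S. S \<subseteq> X \<and> finite S}"
    have C: "C \<noteq> {}" "C \<subseteq> congruences A"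
      using \<Lambda>[OF x] by (auto simp: C_def)
    have directed: "\<exists>\<gamma>\<in>C. \<alpha> \<union> \<beta> \<subseteq> \<gamma>" if \<alpha>\<beta>: "\<alpha> \<in> C" "\<beta> \<in> C" for \<alpha> \<beta>
    proof -
      obtain S T where "S \<subseteq> X" "finite S" "\<alpha> = \<Lambda> x S" "T \<subseteq> X" "finite T" "\<beta> = \<Lambda> x T"
        using \<alpha>\<beta> by (auto simp: C_def)
      then show ?thesis
        using \<Lambda>_mono[of S "S \<union> T" x] \<Lambda>_mono[of T "S \<union> T" x]
        by (intro bexI[of _ "\<Lambda> x (S \<union> T)"]) (auto simp: C_def)
    qed
    have cong: "\<Inter>{\<kappa>\<^sub>1 x, \<kappa>\<^sub>2 x} \<in> congruences A"
      using \<kappa>[OF x] by (intro congruences_Inter) auto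
    have "(t, x) \<in> E (\<Inter>{\<kappa>\<^sub>1 x, \<kappa>\<^sub>2 x})"
      using con_ext_Inter[OF ext, of "{\<kappa>\<^sub>1 x, \<kappa>\<^sub>2 x}"] \<kappa>[OF x] tx by (simp add: E_def)
    also have "\<dots> \<subseteq> E (\<Union>C)"
      unfolding E_def using cong \<kappa>_subset[OF x] congruences_directed_Union[OF C directed]
      by (intro con_ext_mono[OF ext]) (auto simp: C_def)
    also have "\<dots> = \<Union>(E ` C)"
      unfolding E_def by (rule con_ext_directed_Union[OF ext C directed])
    finally show ?thesis by (auto simp: C_def)
  qed

  \<comment> \<open>The element \<open>t\<close> obtained from permutability\<close>
  define \<alpha> where "\<alpha> = \<Inter>(\<kappa>\<^sub>1 ` Z)"
  define \<beta> where "\<beta> = \<Inter>(\<kappa>\<^sub>2 ` Z)"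
  have "Z \<noteq> {}" using Z by auto
  then have con: "\<alpha> \<in> congruences A" "\<beta> \<in> congruences A"
    unfolding \<alpha>_def \<beta>_def using \<kappa> by (auto intro!: congruences_Inter)
  have in_F: "a0 \<in> carrier F" "a1 \<in> carrier F" "a2 \<in> carrier F" "\<And>x. x \<in> Z \<Longrightarrow> x \<in> carrier F"
    using a0 a1 a2 X Z by auto
  have \<kappa>\<^sub>1_mem: "(a1, a2) \<in> \<kappa>\<^sub>1 x" "(a0, x) \<in> \<kappa>\<^sub>1 x"
    and \<kappa>\<^sub>2_mem: "(a0, a1) \<in> \<kappa>\<^sub>2 x" "(x, a2) \<in> \<kappa>\<^sub>2 x" if x: "x \<in> Z" for x
  proof -
    have "h a1 \<sqinter> r = h a2 \<sqinter> r \<and> h a0 \<sqinter> r = h x \<sqinter> r \<and> h a0 \<sqinter> c = h a1 \<sqinter> c \<and> h x \<sqinter> c = h a2 \<sqinter> c"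
      if "adm c x X h" "c \<in> {p, q}" for c h
    proof -
      interpret lattice_square K r c u v using square that by blast
      show ?thesis using that(1) by (simp add: adm_def square_table)
    qed
    then show "(a1, a2) \<in> \<kappa>\<^sub>1 x" "(a0, x) \<in> \<kappa>\<^sub>1 x" "(a0, a1) \<in> \<kappa>\<^sub>2 x" "(x, a2) \<in> \<kappa>\<^sub>2 x"
      using in_F x by (auto simp: \<kappa>\<^sub>1_def \<kappa>\<^sub>2_def lattice_kernel_def)
  qed
  have E_con: "E \<alpha> \<in> congruences B" "E \<beta> \<in> congruences B"
    using con con_ext_congruence[OF ext] by (simp_all add: E_def)
  have "(a0, a1) \<in> \<beta>" "(a1, a2) \<in> \<alpha>"
    using \<kappa>\<^sub>1_mem \<kappa>\<^sub>2_mem by (simp_all add: \<alpha>_def \<beta>_def)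
  then have "(a0, a1) \<in> E \<beta>" "(a1, a2) \<in> E \<alpha>"
    unfolding E_def using subset_con_ext[OF ext] con by blast+
  \<comment> \<open>The path through \<open>a1\<close> uses \<open>E \<beta>\<close> first and then
    \<open>E \<alpha>\<close>; permuting gives a path with the opposite order, whose midpoint is
    \<open>t\<close>.\<close>
  then have "(a0, a2) \<in> E \<alpha> O E \<beta>"
    using perm E_con unfolding congruence_permutable_def by blast
  then obtain t where t: "(a0, t) \<in> E \<alpha>" "(t, a2) \<in> E \<beta>"
    by blast
  have "\<exists>S. S \<subseteq> X \<and> finite S \<and> (t, x) \<in> E (\<Lambda> x S)" if x: "x \<in> Z" for x
  proof (rule finite_support[OF x])
    have eqv: "equiv (universe B) (E (\<kappa>\<^sub>1 x))" "equiv (universe B) (E (\<kappa>\<^sub>2 x))"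
      using \<kappa>[OF x] by (auto simp: E_def intro!: congruences_equiv con_ext_congruence[OF ext])
    have "\<alpha> \<subseteq> \<kappa>\<^sub>1 x" "\<beta> \<subseteq> \<kappa>\<^sub>2 x"
      using x by (auto simp: \<alpha>_def \<beta>_def)
    then have "E \<alpha> \<subseteq> E (\<kappa>\<^sub>1 x)" "E \<beta> \<subseteq> E (\<kappa>\<^sub>2 x)"
      unfolding E_def using con \<kappa>[OF x] by (simp_all add: con_ext_mono[OF ext])
    then have "(a0, t) \<in> E (\<kappa>\<^sub>1 x)" "(t, a2) \<in> E (\<kappa>\<^sub>2 x)"
      using t by auto
    \<comment> \<open>Modulo the two congruences for \<open>x\<close>, the generator
      \<open>x\<close> is a midpoint between \<open>a0\<close> and \<open>a2\<close> just as
      \<open>t\<close> is, so both congruences relate \<open>t\<close> to \<open>x\<close>.\<close>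
    moreover have "(a0, x) \<in> E (\<kappa>\<^sub>1 x)" "(x, a2) \<in> E (\<kappa>\<^sub>2 x)"
      unfolding E_def using \<kappa>\<^sub>1_mem[OF x] \<kappa>\<^sub>2_mem[OF x] subset_con_ext[OF ext] \<kappa>[OF x] by blast+
    ultimately show "(t, x) \<in> E (\<kappa>\<^sub>1 x)" "(t, x) \<in> E (\<kappa>\<^sub>2 x)"
      using eqv by (meson equivE symD transD)+
  qed
  then obtain S where S: "\<And>x. x \<in> Z \<Longrightarrow> S x \<subseteq> X \<and> finite (S x) \<and> (t, x) \<in> E (\<Lambda> x (S x))"
    by metis

  \<comment> \<open>Contradiction from a free pair of generators\<close>
  obtain x y where xy: "x \<in> Z" "y \<in> Z" "x \<noteq> y" "x \<notin> S y" "y \<notin> S x"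
    using uncountable_free_pair[OF Z(1), of S] S by blast
  \<comment> \<open>Admissibility for \<open>x\<close> is violated only at \<open>y\<close>, which
    lies outside \<open>S x\<close>, and symmetrically for \<open>y\<close>. Hence one map is
    admissible for both finite sets.\<close>
  have "(\<lambda>w. if w = x then p else if w = y then q else if w = a1 then r else if w = a2 then v else u)
      \<in> X \<rightarrow> carrier K"
    using pqr uv by auto
  from extend[OF this] obtain h where "h \<in> H" and h: "\<And>w. w \<in> X \<Longrightarrow>
      h w = (if w = x then p else if w = y then q else if w = a1 then r else if w = a2 then v else u)"
    by blast
  have *: "adm p x (S x) h" "adm q y (S y) h"
    using \<open>h \<in> H\<close> h S xy a0 a1 a2 by (auto simp: adm_def Z_def subset_iff)
  have ker: "lattice_kernel F h \<in> congruences A"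
    using hom_kernel * by blast
  have "\<Lambda> x (S x) \<subseteq> lattice_kernel F h" "\<Lambda> y (S y) \<subseteq> lattice_kernel F h"
    using * unfolding \<Lambda>_def by blast+
  then have "E (\<Lambda> x (S x)) \<subseteq> E (lattice_kernel F h)" "E (\<Lambda> y (S y)) \<subseteq> E (lattice_kernel F h)"
    unfolding E_def using \<Lambda> S xy ker by (simp_all add: con_ext_mono[OF ext])
  then have "(t, x) \<in> E (lattice_kernel F h)" "(t, y) \<in> E (lattice_kernel F h)"
    using S xy by auto
  moreover have "equiv (universe B) (E (lattice_kernel F h))"
    unfolding E_def using ker by (intro congruences_equiv con_ext_congruence[OF ext])
  ultimately have "(x, y) \<in> E (lattice_kernel F h)"
    by (meson equivE symD transD)
  then have "(x, y) \<in> lattice_kernel F h"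
    using con_ext_restrict[OF ext ker] in_F xy A(1) by (auto simp: E_def)
  then have "h x = h y" by (simp add: lattice_kernel_def)
  then show False
    using h[of x] h[of y] xy(1-3) Z(2) pqr(4) by auto
qed

section \<open>Countable nondistributive lattices on a given type\<close>

instance lattice_term :: (countable) countable
  by countable_datatype

text \<open>The universal property in \<open>free_object\<close> is tested only on lattices over
  \<open>'a\<close>, so the failure of cancellation in \<open>M\<close> is copied there; the
  infinite set \<open>X\<close> makes room for a countable sublattice. Taking the common meet and
  join as bounds lets \<open>K\<close> serve the bounded case too.\<close>

lemma small_square_pair:
  fixes M :: "'m gorder" and X :: "'a set"
  assumes M: "M \<in> variety E" "\<not> distributive M" and "infinite X"
  obtains K :: "'a gorder" and p q r
  where "K \<in> bounded_variety E" "p \<in> carrier K" "q \<in> carrier K" "r \<in> carrier K" "p \<noteq> q"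
    "r \<sqinter>\<^bsub>K\<^esub> p = \<bottom>\<^bsub>K\<^esub>" "r \<sqinter>\<^bsub>K\<^esub> q = \<bottom>\<^bsub>K\<^esub>" "r \<squnion>\<^bsub>K\<^esub> p = \<top>\<^bsub>K\<^esub>" "r \<squnion>\<^bsub>K\<^esub> q = \<top>\<^bsub>K\<^esub>"
proof -
  have "lattice M" using M by (simp add: variety_def)
  then interpret M: lattice M .
  obtain p q r where pqr: "p \<in> carrier M" "q \<in> carrier M" "r \<in> carrier M" "p \<noteq> q"
    "r \<sqinter>\<^bsub>M\<^esub> p = r \<sqinter>\<^bsub>M\<^esub> q" "r \<squnion>\<^bsub>M\<^esub> p = r \<squnion>\<^bsub>M\<^esub> q"
    using distributive_if_cancellative[OF \<open>lattice M\<close>] M(2) by metis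
  define u v where uv: "u = r \<sqinter>\<^bsub>M\<^esub> p" "v = r \<squnion>\<^bsub>M\<^esub> p"
  have uv_in: "u \<in> carrier M" "v \<in> carrier M"
    using pqr by (auto simp: uv)
  \<comment> \<open>The values of terms at \<open>p\<close>, \<open>q\<close>, \<open>r\<close> form
    the generated sublattice, countable because there are countably many terms.\<close>
  define w where "w n = (if n = 0 then p else if n = 1 then q else r)" for n :: nat
  define T where "T = range (eval_term M w)"
  have w_between: "w n \<in> carrier M" "u \<sqsubseteq>\<^bsub>M\<^esub> w n" "w n \<sqsubseteq>\<^bsub>M\<^esub> v" for n
    using pqr M.meet_left[of r p] M.meet_right[of r p] M.meet_right[of r q]
      M.join_left[of r p] M.join_right[of r p] M.join_right[of r q]
    by (simp_all add: uv w_def)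
  \<comment> \<open>The interval from \<open>u\<close> to \<open>v\<close> is closed under both
    operations, so \<open>u\<close> and \<open>v\<close> bound the whole sublattice.\<close>
  have between: "eval_term M w t \<in> carrier M \<and> u \<sqsubseteq>\<^bsub>M\<^esub> eval_term M w t \<and> eval_term M w t \<sqsubseteq>\<^bsub>M\<^esub> v" for t
  proof (induction t)
    case (JoinT s t)
    then show ?case
      using uv_in M.le_trans[OF _ M.join_left, of u "eval_term M w s" "eval_term M w t"]
      by (auto intro!: M.join_le)
  next
    case (MeetT s t)
    then show ?case
      using uv_in M.le_trans[OF M.meet_left, of "eval_term M w s" "eval_term M w t" v]
      by (auto intro!: M.meet_le)
  qed (simp add: w_between)
  have T_join: "a \<squnion>\<^bsub>M\<^esub> b \<in> T" and T_meet: "a \<sqinter>\<^bsub>M\<^esub> b \<in> T" if "a \<in> T" "b \<in> T" for a b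
    using that by (auto simp: T_def simp flip: eval_term.simps(2,3))
  have T_mem: "p \<in> T" "q \<in> T" "r \<in> T"
    using rangeI[of "eval_term M w" "Var 0"] rangeI[of "eval_term M w" "Var 1"]
      rangeI[of "eval_term M w" "Var 2"] by (simp_all add: T_def w_def)
  then have uv_T: "u \<in> T" "v \<in> T"
    using T_join T_meet by (simp_all add: uv)
  have T_between: "u \<sqsubseteq>\<^bsub>M\<^esub> a \<and> a \<sqsubseteq>\<^bsub>M\<^esub> v" if "a \<in> T" for a
    using between that by (auto simp: T_def)
  have "countable T" by (simp add: T_def)
  obtain f :: "nat \<Rightarrow> 'a" where f: "inj f"
    using infinite_countable_subset[OF \<open>infinite X\<close>] by blast
  define e where "e = f \<circ> to_nat_on T"
  have e: "inj_on e T"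
    unfolding e_def using f \<open>countable T\<close> by (intro comp_inj_on inj_on_to_nat_on) (auto intro: inj_on_subset)
  define g where "g = inv_into T e"
  have ge: "g (e a) = a" if "a \<in> T" for a
    using e that by (simp add: g_def)
  interpret lattice_pullback M "e ` T" g
    using between by unfold_locales
      (auto simp: ge T_join T_meet inj_on_def image_image T_def[symmetric], auto simp: T_def)
  have eq: "x = e a" if "x \<in> e ` T" "g x = a" for x a
    using that ge by auto
  interpret P: Lattice.lattice P by (rule lattice)
  have "g (e u) \<sqsubseteq>\<^bsub>M\<^esub> g x \<and> g x \<sqsubseteq>\<^bsub>M\<^esub> g (e v)" if "x \<in> e ` T" for x
    using that uv_T T_between by (auto simp: ge)
  then have bounds: "bounded_lattice P" "\<bottom>\<^bsub>P\<^esub> = e u" "\<top>\<^bsub>P\<^esub> = e v"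
    using bounded_lattice[of "e u" "e v"] uv_T by blast+
  show ?thesis
  proof (rule that)
    show "P \<in> bounded_variety E"
      using variety[OF M(1)] uv_T bounds(1) by (auto simp: bounded_variety_def)
    show "e p \<in> carrier P" "e q \<in> carrier P" "e r \<in> carrier P" "e p \<noteq> e q"
      using T_mem pqr(4) ge by auto metis
  qed (use T_mem pqr in \<open>auto intro!: eq P.join_closed[simplified] P.meet_closed[simplified] simp: bounds join meet ge uv\<close>)
qed

section \<open>Finite supports\<close>

text \<open>The condition \<open>support\<close> of \<open>no_permutable_extension\<close> as a
  predicate of \<open>a\<close>, ready for induction over the free object.\<close>

definition finitely_determined :: "('a \<Rightarrow> 'b) set \<Rightarrow> 'a set \<Rightarrow> 'a \<Rightarrow> bool"
  where "finitely_determined H X a \<longleftrightarrow>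
    (\<exists>S\<subseteq>X. finite S \<and> (\<forall>g\<in>H. \<forall>h\<in>H. (\<forall>x\<in>S. g x = h x) \<longrightarrow> g a = h a))"

lemma finitely_determined_generator: "x \<in> X \<Longrightarrow> finitely_determined H X x"
  unfolding finitely_determined_def by (intro exI[of _ "{x}"]) auto

lemma finitely_determined_combine:
  assumes "finitely_determined H X a" "finitely_determined H X b"
    and "\<And>g h. \<lbrakk>g \<in> H; h \<in> H; g a = h a; g b = h b\<rbrakk> \<Longrightarrow> g c = h c"
  shows "finitely_determined H X c"
proof -
  obtain S T where "S \<subseteq> X" "finite S" "\<forall>g\<in>H. \<forall>h\<in>H. (\<forall>x\<in>S. g x = h x) \<longrightarrow> g a = h a"
    "T \<subseteq> X" "finite T" "\<forall>g\<in>H. \<forall>h\<in>H. (\<forall>x\<in>T. g x = h x) \<longrightarrow> g b = h b"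
    using assms(1,2) by (auto simp: finitely_determined_def)
  then show ?thesis
    using assms(3) unfolding finitely_determined_def by (intro exI[of _ "S \<union> T"]) auto
qed

text \<open>\<open>cardSuc natLeq\<close> is aleph-one, the successor of the cardinal of the natural
  numbers.\<close>

lemma uncountable_if_cardSuc_natLeq:
  assumes "|X| =o cardSuc natLeq"
  shows "uncountable X"
proof
  assume "countable X"
  then have "|X| \<le>o natLeq"
    by (simp add: countable_card_le_natLeq)
  then have "cardSuc natLeq \<le>o natLeq"
    using assms ordIso_symmetric ordIso_ordLeq_trans by blast
  then show False
    using cardSuc_greater[OF natLeq_Card_order] not_ordLess_ordLeq by blast
qed

theorem mainTheorem9:
  fixes E :: "(nat lattice_term \<times> nat lattice_term) set"
    and M :: "'m gorder"
  assumes "M \<in> variety E" and "\<not> distributive M"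
  shows
    "(\<forall>(F :: 'a gorder) X.
        free_object (variety E) lattice_hom X F \<and> |X| =o cardSuc natLeq \<longrightarrow>
        \<not> (\<exists>B :: ('g lattice_symbol, 'a) algebra.
              congruence_preserving_extension (lattice_algebra F) B \<and>
              congruence_permutable B)) \<and>
     (\<forall>(F :: 'a gorder) X.
        free_object (bounded_variety E) bounded_lattice_hom X F \<and> |X| =o cardSuc natLeq \<longrightarrow>
        \<not> (\<exists>B :: ('g lattice_symbol, 'a) algebra.
              congruence_preserving_extension (bounded_lattice_algebra F) B \<and>
              congruence_permutable B))"
proof (intro conjI allI impI notI; elim conjE exE)
  fix F :: "'a gorder" and X and B :: "('g lattice_symbol, 'a) algebra"
  assume free: "free_object (variety E) lattice_hom X F" and "|X| =o cardSuc natLeq"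
    and ext: "congruence_preserving_extension (lattice_algebra F) B" and "congruence_permutable B"
  have X: "uncountable X"
    using \<open>|X| =o cardSuc natLeq\<close> by (rule uncountable_if_cardSuc_natLeq)
  then obtain K :: "'a gorder" and p q r where K: "K \<in> bounded_variety E"
    and pqr: "p \<in> carrier K" "q \<in> carrier K" "r \<in> carrier K" "p \<noteq> q"
    "r \<sqinter>\<^bsub>K\<^esub> p = \<bottom>\<^bsub>K\<^esub>" "r \<sqinter>\<^bsub>K\<^esub> q = \<bottom>\<^bsub>K\<^esub>" "r \<squnion>\<^bsub>K\<^esub> p = \<top>\<^bsub>K\<^esub>" "r \<squnion>\<^bsub>K\<^esub> q = \<top>\<^bsub>K\<^esub>"
    using small_square_pair[OF assms uncountable_infinite[OF X]] by metis
  have lat: "lattice F" "lattice K" "X \<subseteq> carrier F" "K \<in> variety E"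
    using free K by (auto simp: free_object_def variety_def bounded_variety_def)
  interpret F: lattice F by fact
  have "X \<noteq> {}" using X by auto
  note induct = free_lattice_induct[OF free this, consumes 1, case_names gen join meet]
  have "\<not> congruence_permutable B"
  proof (rule no_permutable_extension[OF lat(1,2,3) X subset_refl _ _ _ _ _ pqr ext])
    show "\<exists>h\<in>lattice_hom F K. \<forall>x\<in>X. h x = f x" if "f \<in> X \<rightarrow> carrier K" for f
      using free that lat(4) unfolding free_object_def by blast
    have "finitely_determined (lattice_hom F K) X a" if "a \<in> carrier F" for a
      using that
    proof (induction rule: induct)
      case (join a b)
      from join(3,4) show ?case
        by (rule finitely_determined_combine) (simp add: lattice_homD join(1,2))
    next
      case (meet a b)
      from meet(3,4) show ?case
        by (rule finitely_determined_combine) (simp add: lattice_homD meet(1,2))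
    qed (rule finitely_determined_generator)
    then show "\<exists>S\<subseteq>X. finite S \<and>
        (\<forall>g\<in>lattice_hom F K. \<forall>h\<in>lattice_hom F K. (\<forall>x\<in>S. g x = h x) \<longrightarrow> g a = h a)"
      if "a \<in> carrier F" for a
      using that by (simp add: finitely_determined_def)
    show "h ` carrier F \<subseteq> Y" if h: "h \<in> lattice_hom F K" and gens: "h ` X \<subseteq> Y"
      and ops: "\<And>s t. \<lbrakk>s \<in> Y; t \<in> Y\<rbrakk> \<Longrightarrow> s \<squnion>\<^bsub>K\<^esub> t \<in> Y \<and> s \<sqinter>\<^bsub>K\<^esub> t \<in> Y" for h Y
    proof -
      have "h a \<in> Y" if "a \<in> carrier F" for a
        using that by (induction rule: induct) (use h gens ops in \<open>auto simp: lattice_homD\<close>)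
      then show ?thesis by blast
    qed
  qed (auto simp: lattice_algebra_def intro: lattice_congruence_lattice_algebra[unfolded lattice_algebra_def])
  then show False using \<open>congruence_permutable B\<close> by contradiction
next
  fix F :: "'a gorder" and X and B :: "('g lattice_symbol, 'a) algebra"
  assume free: "free_object (bounded_variety E) bounded_lattice_hom X F" and "|X| =o cardSuc natLeq"
    and ext: "congruence_preserving_extension (bounded_lattice_algebra F) B" and "congruence_permutable B"
  have X: "uncountable X"
    using \<open>|X| =o cardSuc natLeq\<close> by (rule uncountable_if_cardSuc_natLeq)
  then obtain K :: "'a gorder" and p q r where K: "K \<in> bounded_variety E"
    and pqr: "p \<in> carrier K" "q \<in> carrier K" "r \<in> carrier K" "p \<noteq> q"
    "r \<sqinter>\<^bsub>K\<^esub> p = \<bottom>\<^bsub>K\<^esub>" "r \<sqinter>\<^bsub>K\<^esub> q = \<bottom>\<^bsub>K\<^esub>" "r \<squnion>\<^bsub>K\<^esub> p = \<top>\<^bsub>K\<^esub>" "r \<squnion>\<^bsub>K\<^esub> q = \<top>\<^bsub>K\<^esub>"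
    using small_square_pair[OF assms uncountable_infinite[OF X]] by metis
  have lat: "lattice F" "lattice K" "X \<subseteq> carrier F" "bounded_lattice F"
    using free K by (auto simp: free_object_def variety_def bounded_variety_def)
  interpret F: bounded_lattice F by fact
  let ?H = "bounded_lattice_hom F K"
  have H: "?H \<subseteq> lattice_hom F K"
    by (auto simp: bounded_lattice_hom_def)
  have H_bounds: "h \<bottom>\<^bsub>F\<^esub> = \<bottom>\<^bsub>K\<^esub>" "h \<top>\<^bsub>F\<^esub> = \<top>\<^bsub>K\<^esub>" if "h \<in> ?H" for h
    using that by (auto simp: bounded_lattice_hom_def)
  note H_hom = lattice_homD[OF H[THEN subsetD]]
  note induct = free_bounded_lattice_induct[OF free, consumes 1, case_names gen bot top join meet]
  have "\<not> congruence_permutable B"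
  proof (rule no_permutable_extension[OF lat(1,2,3) X H _ _ _ _ _ pqr ext])
    show "\<exists>h\<in>?H. \<forall>x\<in>X. h x = f x" if "f \<in> X \<rightarrow> carrier K" for f
      using free that K unfolding free_object_def by blast
    \<comment> \<open>The bounds of \<open>F\<close> have empty support, since all bounded
      homomorphisms into \<open>K\<close> agree on them.\<close>
    have "finitely_determined ?H X a" if "a \<in> carrier F" for a
      using that
    proof (induction rule: induct)
      case (join a b)
      from join(3,4) show ?case
        by (rule finitely_determined_combine) (simp add: H_hom join(1,2))
    next
      case (meet a b)
      from meet(3,4) show ?case
        by (rule finitely_determined_combine) (simp add: H_hom meet(1,2))
    qed (auto intro: finitely_determined_generator simp: finitely_determined_def H_bounds)
    then show "\<exists>S\<subseteq>X. finite S \<and> (\<forall>g\<in>?H. \<forall>h\<in>?H. (\<forall>x\<in>S. g x = h x) \<longrightarrow> g a = h a)"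
      if "a \<in> carrier F" for a
      using that by (simp add: finitely_determined_def)
    \<comment> \<open>Here \<open>u\<close> and \<open>v\<close> are the bounds of \<open>K\<close>,
      so \<open>Y\<close> contains the images of the constants.\<close>
    show "h ` carrier F \<subseteq> Y" if h: "h \<in> ?H" and gens: "h ` X \<subseteq> Y" "\<bottom>\<^bsub>K\<^esub> \<in> Y" "\<top>\<^bsub>K\<^esub> \<in> Y"
      and ops: "\<And>s t. \<lbrakk>s \<in> Y; t \<in> Y\<rbrakk> \<Longrightarrow> s \<squnion>\<^bsub>K\<^esub> t \<in> Y \<and> s \<sqinter>\<^bsub>K\<^esub> t \<in> Y" for h Y
    proof -
      have "h a \<in> Y" if "a \<in> carrier F" for a
        using that by (induction rule: induct) (use h gens ops in \<open>auto simp: H_hom H_bounds\<close>)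
      then show ?thesis by blast
    qed
  qed (auto simp: bounded_lattice_algebra_def
      intro: lattice_congruence_bounded_lattice_algebra[OF lat(4), unfolded bounded_lattice_algebra_def])
  then show False using \<open>congruence_permutable B\<close> by contradiction
qed

end
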